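(* For every non-negative integer $n$ there is an expansion, valid for all complex numbers $x,y$ (with $x+y\ne0$ when $n$ is odd), $$\frac{x^n+y^n}{(x+y)^{\delta(n)}}=\sum_{k=0}^{\lfloor n/2\rfloor}\Psi_k(n)\,(xy)^{\lfloor n/2\rfloor-k}(x^2+y^2)^k,$$ whose coefficients $\Psi_k(n)$ are integers, with $$\Psi_0(n)=\begin{cases}+2 & n\equiv 0\pmod 8\\ +1 & n\equiv\pm1\pmod 8\\ 0& n\equiv\pm2\pmod 8\\ -1& n\equiv\pm3\pmod 8\\ -2& n\equiv 4\pmod 8,\end{cases}$$ and, for each $1\le k\le\lfloor n/2\rfloor$: - $n\equiv0\pmod 8$: $\Psi_k(n)=0$ for $k$ odd, and $\displaystyle\Psi_k(n)=2(-1)^{\lfloor k/2\rfloor}\frac{\prod_{\lambda=0}^{\lfloor k/2\rfloor-1}(n^2-(4\lambda)^2)}{4^k\,k!}$ for $k$ even. - $n\equiv2\pmod 8$: $\Psi_k(n)=0$ for $k$ even, and $\displaystyle\Psi_k(n)=2(-1)^{\lfloor k/2\rfloor}\,n\,\frac{\prod_{\lambda=1}^{\lfloor k/2\rfloor}(n^2-(4\lambda-2)^2)}{4^k\,k!}$ for $k$ odd. - $n\equiv4\pmod 8$: $\Psi_k(n)=0$ for $k$ odd, and $\displaystyle\Psi_k(n)=2(-1)^{\lfloor k/2\rfloor+1}\frac{\prod_{\lambda=0}^{\lfloor k/2\rfloor-1}(n^2-(4\lambda)^2)}{4^k\,k!}$ for $k$ even. - $n\equiv6\pmod 8$: $\Psi_k(n)=0$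 for $k$ even, and $\displaystyle\Psi_k(n)=2(-1)^{\lfloor k/2\rfloor+1}\,n\,\frac{\prod_{\lambda=1}^{\lfloor k/2\rfloor}(n^2-(4\lambda-2)^2)}{4^k\,k!}$ for $k$ odd. - $n\equiv1\pmod 8$: $\displaystyle\Psi_k(n)=(-1)^{\lfloor k/2\rfloor}(n+1-2k)^{\delta(k)}\frac{\prod_{\lambda=1}^{\lfloor k/2\rfloor}((n+1)^2-(4\lambda-2)^2)}{4^k\,k!}$. - $n\equiv3\pmod 8$: $\displaystyle\Psi_k(n)=(-1)^{\lfloor k/2\rfloor+\delta(k-1)}(n+1)(n+1-2k)^{\delta(k-1)}\frac{\prod_{\lambda=1}^{\lfloor (k-1)/2\rfloor}((n+1)^2-(4\lambda)^2)}{4^k\,k!}$. - $n\equiv5\pmod 8$: $\displaystyle\Psi_k(n)=(-1)^{\lfloor k/2\rfloor+1}(n+1-2k)^{\delta(k)}\frac{\prod_{\lambda=1}^{\lfloor k/2\rfloor}((n+1)^2-(4\lambda-2)^2)}{4^k\,k!}$. - $n\equiv7\pmod 8$: $\displaystyle\Psi_k(n)=(-1)^{\lfloor k/2\rfloor+\delta(k)}(n+1)(n+1-2k)^{\delta(k-1)}\frac{\prod_{\lambda=1}^{\lfloor (k-1)/2\rfloor}((n+1)^2-(4\lambda)^2)}{4^k\,k!}$.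
   Context: For an integer $m\ge0$, $\delta(m)\in\{0,1\}$ is the residue of $m$ modulo $2$. Empty products equal $1$, and $a^0=1$ for every $a$ (including $a=0$). *)

theory Defs
  imports Complex_Main
begin

definition \<delta> :: "nat \<Rightarrow> nat" where
  "\<delta> m = m mod 2"

end

theory Submission
  imports Defs
begin

text \<open>
  Put \<open>t = x y\<close>, \<open>s = x\<^sup>2 + y\<^sup>2\<close> and let \<open>F m\<close> be the left-hand side for \<open>n = 2 m\<close> (or for
  \<open>n = 2 m + 1\<close>). Since \<open>x\<^sup>2\<close> and \<open>y\<^sup>2\<close> are the roots of \<open>X\<^sup>2 - s X + t\<^sup>2\<close>, in both cases
  \<open>F (m + 2) = s F (m + 1) - t\<^sup>2 F m\<close>. This is the recurrence of Chebyshev polynomials in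
  \<open>s / (2 t)\<close>, homogenised by \<open>t ^ m\<close>: the even case is \<open>2 T\<^sub>m = U\<^sub>m - U\<^sub>m\<^sub>-\<^sub>2\<close> and the odd case is
  \<open>U\<^sub>m - U\<^sub>m\<^sub>-\<^sub>1\<close>. The coefficients of \<open>U\<^sub>m\<close> are signed binomial coefficients. Hence, with
  \<open>N = (m + k) div 2\<close>, the coefficients sought are up to sign \<open>C(N, k)\<close> for odd \<open>n\<close>, and for even
  \<open>n\<close> they are \<open>C(N, k) + C(N - 1, k)\<close> if \<open>m - k\<close> is even and \<open>0\<close> otherwise. These numbers
  are integers by construction, and their recurrence (\<open>odd_coeff_rec\<close>, \<open>even_coeff_rec\<close>) is
  Pascal's rule.

  The products in the statement come from writing \<open>4 ^ k * k! * C(N, k)\<close> as a product of \<open>k\<close>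
  numbers in arithmetic progression with difference \<open>4\<close>. For odd \<open>n\<close> this progression is symmetric
  about \<open>n + 1\<close>, if necessary after its smallest term is split off (\<open>gbinomial_centred\<close>,
  \<open>gbinomial_centred_split\<close>). For even \<open>n\<close> the progressions of the two binomial coefficients have
  \<open>k - 1\<close> terms in common, and these are symmetric about \<open>n\<close> (\<open>gbinomial_sum_centred\<close>).
  Opposite factors \<open>a + d\<close> and \<open>a - d\<close> pair up to \<open>a\<^sup>2 - d\<^sup>2\<close>. The residue of \<open>n\<close> modulo eight
  carries the parities of \<open>n\<close>, \<open>m\<close> and \<open>m div 2\<close>: the first two fix the shape of the product, and
  all three enter the sign.
\<close>

section \<open>The coefficients and their recurrence\<close>

text \<open>
  This is \<open>(-1) ^ ((d + 1) div 2)\<close> for \<open>d = m - k\<close>; it depends on \<open>d\<close> modulo \<open>4\<close> only, and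
  \<open>m + 3 * k\<close> represents that class without truncated subtraction.
\<close>
definition coeff_sign :: "nat \<Rightarrow> nat \<Rightarrow> int" where
  "coeff_sign m k = (-1) ^ ((m + 3 * k + 1) div 2)"

text \<open>
  For \<open>m = k = 0\<close> the truncated \<open>0 - 1 = 0\<close> gives the value \<open>2\<close>, which is the correct coefficient
  of \<open>x\<^sup>0 + y\<^sup>0\<close>.
\<close>
definition even_coeff :: "nat \<Rightarrow> nat \<Rightarrow> int" where
  "even_coeff m k = (if even (m + k)
     then coeff_sign m k * int (((m + k) div 2 choose k) + ((m + k) div 2 - 1 choose k)) else 0)"

definition odd_coeff :: "nat \<Rightarrow> nat \<Rightarrow> int" where
  "odd_coeff m k = coeff_sign m k * int ((m + k) div 2 choose k)"

lemma minus_one_power_cong: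
  "even a = even b \<Longrightarrow> (-1 :: 'a::ring_1) ^ a = (-1) ^ b"
  by (simp add: minus_one_power_iff)

lemma coeff_sign_rec_0: "coeff_sign (m + 2) 0 = - coeff_sign m 0"
  by (simp add: coeff_sign_def)

lemma coeff_sign_rec_Suc:
  "coeff_sign (m + 1) k = coeff_sign (m + 2) (Suc k)"
  "coeff_sign m (Suc k) = - coeff_sign (m + 2) (Suc k)"
proof -
  have "(m + 2 + 3 * Suc k + 1) div 2 = (m + 1 + 3 * k + 1) div 2 + 2"
    and "(m + 2 + 3 * Suc k + 1) div 2 = (m + 3 * Suc k + 1) div 2 + 1"
    by presburger+
  then show "coeff_sign (m + 1) k = coeff_sign (m + 2) (Suc k)"
    and "coeff_sign m (Suc k) = - coeff_sign (m + 2) (Suc k)"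
    unfolding coeff_sign_def by (simp_all only: power_add) simp_all
qed

text \<open>
  The signs are chosen so that in the second equation of each of the next two lemmas they cancel
  and leave Pascal's rule.
\<close>
lemma odd_coeff_rec:
  "odd_coeff (m + 2) 0 = - odd_coeff m 0"
  "odd_coeff (m + 2) (Suc k) = odd_coeff (m + 1) k - odd_coeff m (Suc k)"
proof -
  show "odd_coeff (m + 2) 0 = - odd_coeff m 0"
    unfolding odd_coeff_def coeff_sign_rec_0 by simp
  define N where "N = (m + k + 1) div 2"
  have "(m + 2 + Suc k) div 2 = Suc N" "(m + 1 + k) div 2 = N" "(m + Suc k) div 2 = N"
    unfolding N_def by simp_all
  then show "odd_coeff (m + 2) (Suc k) = odd_coeff (m + 1) k - odd_coeff m (Suc k)"
    unfolding odd_coeff_def coeff_sign_rec_Suc[of m k] by (simp add: algebra_simps)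
qed

lemma even_coeff_rec:
  "even_coeff (m + 2) 0 = - even_coeff m 0"
  "even_coeff (m + 2) (Suc k) = even_coeff (m + 1) k - even_coeff m (Suc k)"
proof -
  show "even_coeff (m + 2) 0 = - even_coeff m 0"
    unfolding even_coeff_def coeff_sign_rec_0 by simp
  show "even_coeff (m + 2) (Suc k) = even_coeff (m + 1) k - even_coeff m (Suc k)"
  proof (cases "even (m + k + 1)")
    case True
    then obtain M where M: "m + k + 1 = 2 * Suc M"
      by (metis add_is_0 evenE mult_0_right not0_implies_Suc one_neq_zero)
    then have half: "(m + 2 + Suc k) div 2 = Suc (Suc M)" "(m + 1 + k) div 2 = Suc M"
        "(m + Suc k) div 2 = Suc M"
      by simp_all
    have parity: "even (m + 2 + Suc k)" "even (m + 1 + k)" "even (m + Suc k)"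
      using True by simp_all
    show ?thesis
      unfolding even_coeff_def if_P[OF parity(1)] if_P[OF parity(2)] if_P[OF parity(3)] half
        coeff_sign_rec_Suc[of m k]
      by (simp add: algebra_simps)
  next
    case False
    then show ?thesis by (simp add: even_coeff_def)
  qed
qed

lemma odd_coeff_eq_0: "m < k \<Longrightarrow> odd_coeff m k = 0"
  by (simp add: odd_coeff_def binomial_eq_0)

lemma even_coeff_eq_0: "m < k \<Longrightarrow> even_coeff m k = 0"
  by (auto simp: even_coeff_def binomial_eq_0)

section \<open>The expansion\<close>

definition coeff_form :: "(nat \<Rightarrow> nat \<Rightarrow> int) \<Rightarrow> nat \<Rightarrow> 'a::comm_ring_1 \<Rightarrow> 'a \<Rightarrow> 'a" where
  "coeff_form c m t s = (\<Sum>k = 0..m. of_int (c m k) * t ^ (m - k) * s ^ k)"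

text \<open>Comparing coefficients of \<open>t ^ (m + 2 - k) * s ^ k\<close> in the recurrence for the forms.\<close>
lemma coeff_form_rec:
  assumes rec0: "\<And>m. c (m + 2) 0 = - c m 0"
    and recS: "\<And>m k. c (m + 2) (Suc k) = c (m + 1) k - c m (Suc k)"
    and zero: "\<And>m k. m < k \<Longrightarrow> c m k = 0"
  shows "coeff_form c (m + 2) t s = s * coeff_form c (m + 1) t s - t\<^sup>2 * coeff_form c m t s"
proof -
  have shift: "(\<Sum>k = 0..m + 1. of_int (c m (Suc k)) * t ^ (m + 1 - k) * s ^ Suc k)
      + of_int (c m 0) * t ^ (m + 2) = t\<^sup>2 * coeff_form c m t s" (is "?A + ?B = _")
  proof -
    have "?A + ?B = (\<Sum>k = 0..m + 2. of_int (c m k) * t ^ (m + 2 - k) * s ^ k)"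
      by (simp add: sum.atLeast0_atMost_Suc_shift[where n = "Suc m"] del: sum.cl_ivl_Suc)
    also have "\<dots> = (\<Sum>k = 0..m. of_int (c m k) * t ^ (m + 2 - k) * s ^ k)"
      by (simp add: zero)
    also have "\<dots> = t\<^sup>2 * coeff_form c m t s"
      unfolding coeff_form_def sum_distrib_left
      by (intro sum.cong refl) (simp add: Suc_diff_le power2_eq_square mult_ac)
    finally show ?thesis .
  qed
  have "coeff_form c (m + 2) t s = of_int (c (m + 2) 0) * t ^ (m + 2)
      + (\<Sum>k = 0..m + 1. of_int (c (m + 2) (Suc k)) * t ^ (m + 1 - k) * s ^ Suc k)"
    unfolding coeff_form_def
    by (simp add: sum.atLeast0_atMost_Suc_shift[where n = "Suc m"] del: sum.cl_ivl_Suc)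
  also have "\<dots> = (\<Sum>k = 0..m + 1. of_int (c (m + 1) k) * t ^ (m + 1 - k) * s ^ Suc k)
      - (?A + ?B)"
    unfolding rec0 recS by (simp add: left_diff_distrib sum_subtractf del: sum.cl_ivl_Suc)
  also have "(\<Sum>k = 0..m + 1. of_int (c (m + 1) k) * t ^ (m + 1 - k) * s ^ Suc k)
      = s * coeff_form c (m + 1) t s"
    unfolding coeff_form_def sum_distrib_left by (intro sum.cong refl) (simp add: mult_ac)
  finally show ?thesis unfolding shift .
qed

text \<open>
  Going up by \<open>4\<close> in the exponent is going up by two in powers of \<open>x\<^sup>2\<close> and \<open>y\<^sup>2\<close>, whose sum and
  product are the coefficients here. Parity of the exponent is preserved, so even and odd exponents
  can be treated alike.
\<close>
lemma power_sum_rec: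
  fixes x y :: "'a::comm_ring_1"
  shows "x ^ (n + 4) + y ^ (n + 4)
    = (x\<^sup>2 + y\<^sup>2) * (x ^ (n + 2) + y ^ (n + 2)) - (x * y)\<^sup>2 * (x ^ n + y ^ n)"
  by (simp add: power_add power2_eq_square algebra_simps eval_nat_numeral)

lemma even_expansion:
  fixes x y :: "'a::comm_ring_1"
  shows "x ^ (2 * m) + y ^ (2 * m) = coeff_form even_coeff m (x * y) (x\<^sup>2 + y\<^sup>2)"
proof (induction m rule: induct_nat_012)
  case 0
  show ?case by (simp add: coeff_form_def even_coeff_def coeff_sign_def)
next
  case 1
  show ?case by (simp add: coeff_form_def even_coeff_def coeff_sign_def)
next
  case (ge2 m)
  let ?s = "x\<^sup>2 + y\<^sup>2" and ?G = "\<lambda>m. coeff_form even_coeff m (x * y) (x\<^sup>2 + y\<^sup>2)"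
  have "2 * Suc (Suc m) = 2 * m + 4" by simp
  then have "x ^ (2 * Suc (Suc m)) + y ^ (2 * Suc (Suc m)) = ?s * ?G (m + 1) - (x * y)\<^sup>2 * ?G m"
    using power_sum_rec[of x "2 * m" y] ge2 by (simp only:) simp
  also have "\<dots> = ?G (m + 2)"
    by (simp only: coeff_form_rec[of even_coeff, OF even_coeff_rec even_coeff_eq_0])
  finally show ?case by simp
qed

lemma odd_expansion:
  fixes x y :: "'a::comm_ring_1"
  shows "x ^ (2 * m + 1) + y ^ (2 * m + 1)
    = (x + y) * coeff_form odd_coeff m (x * y) (x\<^sup>2 + y\<^sup>2)"
proof (induction m rule: induct_nat_012)
  case 0
  show ?case by (simp add: coeff_form_def odd_coeff_def coeff_sign_def)
next
  case 1
  have "coeff_form odd_coeff (Suc 0) t s = s - t" for t s :: 'a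
    by (simp add: coeff_form_def odd_coeff_def coeff_sign_def)
  then have form: "coeff_form odd_coeff (Suc 0) (x * y) (x\<^sup>2 + y\<^sup>2) = x\<^sup>2 + y\<^sup>2 - x * y" .
  show ?case
    unfolding One_nat_def form by (simp add: algebra_simps power2_eq_square eval_nat_numeral)
next
  case (ge2 m)
  let ?s = "x\<^sup>2 + y\<^sup>2" and ?G = "\<lambda>m. coeff_form odd_coeff m (x * y) (x\<^sup>2 + y\<^sup>2)"
  have "2 * Suc (Suc m) + 1 = 2 * m + 1 + 4" "2 * Suc m + 1 = 2 * m + 1 + 2" by simp_all
  then have "x ^ (2 * Suc (Suc m) + 1) + y ^ (2 * Suc (Suc m) + 1)
      = ?s * ((x + y) * ?G (Suc m)) - (x * y)\<^sup>2 * ((x + y) * ?G m)"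
    using power_sum_rec[of x "2 * m + 1" y] unfolding ge2[symmetric] by (simp only:)
  also have "\<dots> = (x + y) * (?s * ?G (m + 1) - (x * y)\<^sup>2 * ?G m)"
    by (simp add: algebra_simps)
  also have "\<dots> = (x + y) * ?G (m + 2)"
    by (simp only: coeff_form_rec[of odd_coeff, OF odd_coeff_rec odd_coeff_eq_0])
  finally show ?case by simp
qed

section \<open>Binomial coefficients as symmetric products\<close>

text \<open>The product of the \<open>k\<close> numbers with common difference \<open>4\<close> whose mean is \<open>a\<close>.\<close>
definition centred_prod :: "nat \<Rightarrow> 'a::comm_ring_1 \<Rightarrow> 'a" where
  "centred_prod k a = (\<Prod>i<k. a + 2 * of_nat k - 2 - 4 * of_nat i)"

text \<open>Removing the two outermost factors leaves a progression with the same mean.\<close>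
lemma centred_prod_Suc_Suc:
  "centred_prod (Suc (Suc k)) a = (a\<^sup>2 - (2 * of_nat k + 2)\<^sup>2) * centred_prod k a"
proof -
  have "centred_prod (Suc (Suc k)) a
      = (a + (2 * of_nat k + 2)) * ((\<Prod>i<k. a + 2 * of_nat k - 2 - 4 * of_nat i)
          * (a - (2 * of_nat k + 2)))"
    unfolding centred_prod_def
    by (subst prod.lessThan_Suc_shift, subst prod.lessThan_Suc) (simp add: algebra_simps)
  then show ?thesis
    by (simp add: centred_prod_def power2_eq_square algebra_simps)
qed

lemma centred_prod_even:
  "centred_prod (2 * h) a = (\<Prod>l\<in>{1..h}. a\<^sup>2 - (4 * of_nat l - 2)\<^sup>2)"
proof (induction h)
  case 0
  show ?case by (simp add: centred_prod_def)
next
  case (Suc h)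
  have "2 * of_nat (2 * h) + 2 = (4 * of_nat (Suc h) - 2 :: 'a)" by simp
  then have "centred_prod (2 * Suc h) a
      = (a\<^sup>2 - (4 * of_nat (Suc h) - 2)\<^sup>2) * centred_prod (2 * h) a"
    using centred_prod_Suc_Suc[of "2 * h" a] by (simp only: mult_Suc_right add_2_eq_Suc)
  then show ?case
    using Suc.IH by (simp only: prod.nat_ivl_Suc')
qed

lemma centred_prod_odd:
  "centred_prod (2 * h + 1) a = a * (\<Prod>l\<in>{1..h}. a\<^sup>2 - (4 * of_nat l)\<^sup>2)"
proof (induction h)
  case 0
  show ?case by (simp add: centred_prod_def)
next
  case (Suc h)
  have "2 * of_nat (2 * h + 1) + 2 = (4 * of_nat (Suc h) :: 'a)" by simp
  then have "centred_prod (2 * Suc h + 1) a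
      = (a\<^sup>2 - (4 * of_nat (Suc h))\<^sup>2) * centred_prod (2 * h + 1) a"
    using centred_prod_Suc_Suc[of "2 * h + 1" a]
    by (simp only: mult_Suc_right add_2_eq_Suc add_Suc)
  then show ?case
    using Suc.IH by (simp only: prod.nat_ivl_Suc' mult.left_commute)
qed

lemma gbinomial_scaled:
  fixes z :: rat
  shows "(z gchoose k) * (4 ^ k * fact k) = (\<Prod>i<k. 4 * z - 4 * of_nat i)"
proof -
  have "(z gchoose k) * (4 ^ k * fact k) = 4 ^ k * (\<Prod>i<k. z - of_nat i)"
    using gbinomial_mult_fact[of k z] by (simp add: lessThan_atLeast0 mult_ac)
  also have "\<dots> = (\<Prod>i<k. 4 * (z - of_nat i))"
    by (simp only: prod.distrib prod_constant card_lessThan)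
  finally show ?thesis by (simp add: right_diff_distrib)
qed

lemma gbinomial_centred:
  fixes z :: rat
  shows "(z gchoose k) * (4 ^ k * fact k) = centred_prod k (4 * z + 2 - 2 * of_nat k)"
  unfolding gbinomial_scaled centred_prod_def by simp

text \<open>Here the smallest factor is split off and the others are centred.\<close>
lemma gbinomial_centred_split:
  fixes z :: rat
  shows "(z gchoose Suc k) * (4 ^ Suc k * fact (Suc k))
    = centred_prod k (4 * z + 2 - 2 * of_nat k) * (4 * z - 4 * of_nat k)"
  unfolding gbinomial_scaled centred_prod_def by simp

text \<open>
  The two products share all but one factor each, and the remaining factors \<open>4 * z\<close> and
  \<open>4 * z - 4 * (k + 1)\<close> add up to twice the mean.
\<close>
lemma gbinomial_sum_centred:
  fixes z :: rat and k :: nat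
  defines "a \<equiv> 4 * z - 2 * of_nat (Suc k)"
  shows "((z gchoose Suc k) + (z - 1 gchoose Suc k)) * (4 ^ Suc k * fact (Suc k))
    = 2 * a * centred_prod k a"
proof -
  have "(z gchoose Suc k) * (4 ^ Suc k * fact (Suc k)) = 4 * z * centred_prod k a"
    unfolding gbinomial_scaled centred_prod_def a_def
    by (subst prod.lessThan_Suc_shift) (simp add: algebra_simps)
  moreover have "(z - 1 gchoose Suc k) * (4 ^ Suc k * fact (Suc k))
      = centred_prod k a * (4 * z - 4 * of_nat (Suc k))"
    unfolding gbinomial_scaled centred_prod_def a_def by (simp add: algebra_simps)
  ultimately show ?thesis
    unfolding distrib_right by (simp add: a_def algebra_simps)
qed

text \<open>
  With \<open>N = (m + k) div 2\<close>, the mean of the progression \<open>4 * N, 4 * N - 4, \<dots>\<close> of length \<open>k\<close> is \<open>n + 1\<close>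
  exactly when \<open>m + k\<close> is even; when it is odd, rounding \<open>N\<close> down lowers the mean by \<open>2\<close>, which
  omitting the last term compensates.
\<close>
lemma odd_coeff_same_parity:
  assumes "even (m + k)" and "n = 2 * m + 1"
  shows "(of_int (odd_coeff m k) :: rat)
    = of_int (coeff_sign m k) * centred_prod k (of_nat n + 1) / (4 ^ k * fact k)"
proof -
  obtain N where N: "m + k = 2 * N" using assms(1) by (rule evenE)
  then have mean: "4 * of_nat N + 2 - 2 * of_nat k = (of_nat n + 1 :: rat)"
    using arg_cong[OF N, of "of_nat :: nat \<Rightarrow> rat"] assms(2) by simp
  show ?thesis
    using gbinomial_centred[of "of_nat N" k, unfolded mean] N
    by (simp add: odd_coeff_def binomial_gbinomial field_simps)
qed

lemma odd_coeff_other_parity: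
  assumes "odd (m + k)" and "n = 2 * m + 1" and "k \<ge> 1"
  shows "(of_int (odd_coeff m k) :: rat)
    = of_int (coeff_sign m k) * ((of_nat n + 1 - 2 * of_nat k)
        * centred_prod (k - 1) (of_nat n + 1)) / (4 ^ k * fact k)"
proof -
  obtain N where N: "m + k = 2 * N + 1" using assms(1) by (rule oddE)
  obtain j where j: "k = Suc j" using assms(3) by (cases k) auto
  have N': "of_nat m + of_nat k = (2 * of_nat N + 1 :: rat)"
    using arg_cong[OF N, of "of_nat :: nat \<Rightarrow> rat"] by simp
  have mean: "4 * of_nat N + 2 - 2 * of_nat j = (of_nat n + 1 :: rat)"
    and last: "4 * of_nat N - 4 * of_nat j = (of_nat n + 1 - 2 * of_nat k :: rat)"
    using N' assms(2) j by simp_all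
  have "(of_nat N gchoose k) * (4 ^ k * fact k)
      = (of_nat n + 1 - 2 * of_nat k) * centred_prod (k - 1) (of_nat n + 1 :: rat)"
    using gbinomial_centred_split[of "of_nat N" j, unfolded mean last] by (simp add: j mult_ac)
  then have "of_nat N gchoose k
      = (of_nat n + 1 - 2 * of_nat k) * centred_prod (k - 1) (of_nat n + 1 :: rat) / (4 ^ k * fact k)"
    by (simp add: eq_divide_eq)
  moreover have "odd_coeff m k = coeff_sign m k * int (N choose k)"
    using N by (simp add: odd_coeff_def)
  ultimately show ?thesis by (simp add: binomial_gbinomial)
qed

lemma even_coeff_centred:
  assumes "even (m + k)" and "n = 2 * m" and "k \<ge> 1"
  shows "(of_int (even_coeff m k) :: rat)
    = of_int (coeff_sign m k) * (2 * of_nat n * centred_prod (k - 1) (of_nat n)) / (4 ^ k * fact k)"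
proof -
  obtain N where N: "m + k = 2 * N" using assms(1) by (rule evenE)
  obtain j where j: "k = Suc j" using assms(3) by (cases k) auto
  have mean: "4 * of_nat N - 2 * of_nat (Suc j) = (of_nat n :: rat)"
    using arg_cong[OF N, of "of_nat :: nat \<Rightarrow> rat"] assms(2) j by simp
  have "N \<ge> 1" using N assms(3) by simp
  then have pred: "of_nat (N - 1) = (of_nat N - 1 :: rat)" by simp
  have "even_coeff m k = coeff_sign m k * int ((N choose k) + (N - 1 choose k))"
    using assms(1) N by (simp add: even_coeff_def)
  then have "(of_int (even_coeff m k) :: rat) = of_int (coeff_sign m k)
      * ((of_nat N gchoose k) + (of_nat N - 1 gchoose k))"
    by (simp add: binomial_gbinomial pred[unfolded One_nat_def])
  also have "(of_nat N gchoose k) + (of_nat N - 1 gchoose k)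
      = (2 * of_nat n * centred_prod (k - 1) (of_nat n) :: rat) / (4 ^ k * fact k)"
    using gbinomial_sum_centred[of "of_nat N" j, unfolded mean]
    unfolding j[symmetric] by (simp add: eq_divide_eq j mult_ac)
  finally show ?thesis by simp
qed

text \<open>The factor \<open>n\<close> in front and the central factor \<open>n\<close> are the term \<open>l = 0\<close> of the product.\<close>
lemma even_coeff_even_index:
  assumes "even m" and "even k" and "n = 2 * m" and "k \<ge> 1"
  shows "(of_int (even_coeff m k) :: rat) = of_int (coeff_sign m k)
    * (2 * (\<Prod>l\<in>{0..<k div 2}. of_nat n ^ 2 - (4 * of_nat l) ^ 2)) / (4 ^ k * fact k)"
proof -
  obtain h where h: "k = 2 * Suc h"
    using assms(2,4) by (metis evenE mult_0_right not0_implies_Suc not_one_le_zero)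
  have "of_nat n * centred_prod (k - 1) (of_nat n)
      = (\<Prod>l\<in>{0..<k div 2}. of_nat n ^ 2 - (4 * of_nat l) ^ 2 :: rat)"
    using centred_prod_odd[of h "of_nat n :: rat"]
    by (simp add: h prod.atLeast_Suc_atMost[of 0 h] power2_eq_square
        atLeastLessThanSuc_atLeastAtMost del: prod.op_ivl_Suc)
  then show ?thesis
    using even_coeff_centred[of m k n] assms by (simp add: mult.assoc)
qed

lemma even_coeff_odd_index:
  assumes "odd m" and "odd k" and "n = 2 * m"
  shows "(of_int (even_coeff m k) :: rat) = of_int (coeff_sign m k)
    * (2 * of_nat n * (\<Prod>l\<in>{1..k div 2}. of_nat n ^ 2 - (4 * of_nat l - 2) ^ 2)) / (4 ^ k * fact k)"
proof -
  obtain h where h: "k = 2 * h + 1" using assms(2) by (rule oddE)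
  show ?thesis
    using even_coeff_centred[of m k n] assms centred_prod_even[of h "of_nat n :: rat"]
    by (simp add: h)
qed

text \<open>
  For odd \<open>n\<close> the product runs over \<open>4 * l - 2\<close> when the number of centred factors is even, and over
  \<open>4 * l\<close> with the extra central factor \<open>n + 1\<close> when it is odd. That number is \<open>k\<close> if \<open>m + k\<close> is even
  and \<open>k - 1\<close> otherwise, so it has the parity of \<open>m\<close>, which decides between the two shapes.
\<close>
lemma odd_coeff_even_half:
  assumes "even m" and "n = 2 * m + 1" and "k \<ge> 1"
  shows "(of_int (odd_coeff m k) :: rat) = of_int (coeff_sign m k)
    * ((of_nat n + 1 - 2 * of_nat k) ^ \<delta> k
      * (\<Prod>l\<in>{1..k div 2}. (of_nat n + 1) ^ 2 - (4 * of_nat l - 2) ^ 2)) / (4 ^ k * fact k)"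
proof (cases "even k")
  case True
  then obtain h where h: "k = 2 * h" by (rule evenE)
  have centred: "centred_prod k (of_nat n + 1 :: rat)
      = (\<Prod>l\<in>{1..k div 2}. (of_nat n + 1) ^ 2 - (4 * of_nat l - 2) ^ 2)"
    using centred_prod_even[of h "of_nat n + 1 :: rat"] by (simp add: h)
  have delta: "\<delta> k = 0" by (simp add: h \<delta>_def)
  have parity: "even (m + k)" using assms(1) True by simp
  show ?thesis
    unfolding odd_coeff_same_parity[OF parity assms(2)] centred delta
    by (simp only: power_0 mult_1_left)
next
  case False
  then obtain h where h: "k = 2 * h + 1" by (rule oddE)
  have centred: "centred_prod (k - 1) (of_nat n + 1 :: rat)
      = (\<Prod>l\<in>{1..k div 2}. (of_nat n + 1) ^ 2 - (4 * of_nat l - 2) ^ 2)"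
    using centred_prod_even[of h "of_nat n + 1 :: rat"] by (simp add: h)
  have delta: "\<delta> k = 1" by (simp add: h \<delta>_def)
  have parity: "odd (m + k)" using assms(1) False by simp
  show ?thesis
    unfolding odd_coeff_other_parity[OF parity assms(2,3)] centred delta
    by (simp only: power_one_right)
qed

lemma odd_coeff_odd_half:
  assumes "odd m" and "n = 2 * m + 1" and "k \<ge> 1"
  shows "(of_int (odd_coeff m k) :: rat) = of_int (coeff_sign m k)
    * ((of_nat n + 1) * (of_nat n + 1 - 2 * of_nat k) ^ \<delta> (k - 1)
      * (\<Prod>l\<in>{1..(k - 1) div 2}. (of_nat n + 1) ^ 2 - (4 * of_nat l) ^ 2)) / (4 ^ k * fact k)"
proof (cases "even k")
  case True
  define h where "h = k div 2 - 1"
  have h: "k = 2 * h + 2" using True assms(3) unfolding h_def by presburger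
  have centred: "centred_prod (k - 1) (of_nat n + 1 :: rat)
      = (of_nat n + 1) * (\<Prod>l\<in>{1..(k - 1) div 2}. (of_nat n + 1) ^ 2 - (4 * of_nat l) ^ 2)"
    using centred_prod_odd[of h "of_nat n + 1 :: rat"] by (simp add: h)
  have delta: "\<delta> (k - 1) = 1" by (simp add: h \<delta>_def)
  have parity: "odd (m + k)" using assms(1) True by simp
  show ?thesis
    unfolding odd_coeff_other_parity[OF parity assms(2,3)] centred delta
    by (simp only: power_one_right mult.left_commute mult.assoc)
next
  case False
  then obtain h where h: "k = 2 * h + 1" by (rule oddE)
  have centred: "centred_prod k (of_nat n + 1 :: rat)
      = (of_nat n + 1) * (\<Prod>l\<in>{1..(k - 1) div 2}. (of_nat n + 1) ^ 2 - (4 * of_nat l) ^ 2)"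
    using centred_prod_odd[of h "of_nat n + 1 :: rat"] by (simp add: h)
  have delta: "\<delta> (k - 1) = 0" by (simp add: h \<delta>_def)
  have parity: "even (m + k)" using assms(1) False by simp
  show ?thesis
    unfolding odd_coeff_same_parity[OF parity assms(2)] centred delta
    by (simp only: power_0 mult_1_right)
qed

section \<open>The residue classes modulo eight\<close>

lemma even_half_Suc: "even ((k + 1) div 2) = even (k div 2 + \<delta> k)"
  by (cases "even k") (auto simp: \<delta>_def elim!: evenE oddE)

lemma even_half_Suc':
  assumes "k \<ge> 1"
  shows "odd ((k + 1) div 2) = even (k div 2 + \<delta> (k - 1))"
  using assms by (cases "even k"; cases k) (auto simp: \<delta>_def elim!: evenE oddE)

lemma parity_halves_mod_8:
  fixes n r :: nat
  assumes "n mod 8 = r"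
  shows "even n = even r" and "even (n div 2) = even (r div 2)"
    and "even (n div 2 div 2) = even (r div 2 div 2)"
proof -
  define q where "q = n div 8"
  have n: "n = 2 * (2 * (2 * q)) + r"
    using assms mult_div_mod_eq[of 8 n] by (simp add: q_def)
  have half: "n div 2 = 2 * (2 * q) + r div 2" unfolding n by simp
  have "n div 2 div 2 = 2 * q + r div 2 div 2" unfolding half by simp
  then show "even (n div 2 div 2) = even (r div 2 div 2)" by simp
  show "even n = even r" unfolding n by simp
  show "even (n div 2) = even (r div 2)" unfolding half by simp
qed

text \<open>
  The sign splits into a part depending only on \<open>m\<close>, which the residue class determines, and a part
  depending only on \<open>k\<close>.
\<close>
lemma coeff_sign_even_half:
  assumes "even m"
  shows "coeff_sign m k = (-1) ^ (m div 2 + k div 2)"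
proof -
  obtain p where p: "m = 2 * p" using assms by (rule evenE)
  have "(m + 3 * k + 1) div 2 = p + (3 * k + 1) div 2" unfolding p by simp
  moreover have "even ((3 * k + 1) div 2) = even (k div 2)" by presburger
  ultimately show ?thesis
    unfolding coeff_sign_def by (intro minus_one_power_cong) (simp add: p)
qed

lemma coeff_sign_odd_half:
  assumes "odd m"
  shows "coeff_sign m k = (-1) ^ (m div 2 + (k + 1) div 2 + 1)"
proof -
  obtain p where p: "m = 2 * p + 1" using assms by (rule oddE)
  have "(m + 3 * k + 1) div 2 = p + (3 * k + 2) div 2" unfolding p by simp
  moreover have "even ((3 * k + 2) div 2) = even ((k + 1) div 2 + 1)" by presburger
  ultimately show ?thesis
    unfolding coeff_sign_def by (intro minus_one_power_cong) (simp add: p)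
qed

theorem theorem9:
  fixes n :: nat
  shows "\<exists>\<Psi> :: nat \<Rightarrow> int.
    (\<forall>x y :: complex. (odd n \<longrightarrow> x + y \<noteq> 0) \<longrightarrow>
      (x ^ n + y ^ n) / (x + y) ^ \<delta> n =
      (\<Sum>k = 0..n div 2. of_int (\<Psi> k) * (x * y) ^ (n div 2 - k) * (x\<^sup>2 + y\<^sup>2) ^ k)) \<and>
    (n mod 8 = 0 \<longrightarrow> \<Psi> 0 = 2) \<and>
    (n mod 8 \<in> {1, 7} \<longrightarrow> \<Psi> 0 = 1) \<and>
    (n mod 8 \<in> {2, 6} \<longrightarrow> \<Psi> 0 = 0) \<and>
    (n mod 8 \<in> {3, 5} \<longrightarrow> \<Psi> 0 = -1) \<and>
    (n mod 8 = 4 \<longrightarrow> \<Psi> 0 = -2) \<and>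
    (\<forall>k \<in> {1..n div 2}.
      (n mod 8 = 0 \<longrightarrow>
        (odd k \<longrightarrow> \<Psi> k = 0) \<and>
        (even k \<longrightarrow> (of_int (\<Psi> k) :: rat) =
          2 * (-1) ^ (k div 2) *
          (\<Prod>l\<in>{0..<k div 2}. of_nat n ^ 2 - (4 * of_nat l) ^ 2) / (4 ^ k * fact k))) \<and>
      (n mod 8 = 2 \<longrightarrow>
        (even k \<longrightarrow> \<Psi> k = 0) \<and>
        (odd k \<longrightarrow> (of_int (\<Psi> k) :: rat) =
          2 * (-1) ^ (k div 2) * of_nat n *
          (\<Prod>l\<in>{1..k div 2}. of_nat n ^ 2 - (4 * of_nat l - 2) ^ 2) / (4 ^ k * fact k))) \<and>
      (n mod 8 = 4 \<longrightarrow>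
        (odd k \<longrightarrow> \<Psi> k = 0) \<and>
        (even k \<longrightarrow> (of_int (\<Psi> k) :: rat) =
          2 * (-1) ^ (k div 2 + 1) *
          (\<Prod>l\<in>{0..<k div 2}. of_nat n ^ 2 - (4 * of_nat l) ^ 2) / (4 ^ k * fact k))) \<and>
      (n mod 8 = 6 \<longrightarrow>
        (even k \<longrightarrow> \<Psi> k = 0) \<and>
        (odd k \<longrightarrow> (of_int (\<Psi> k) :: rat) =
          2 * (-1) ^ (k div 2 + 1) * of_nat n *
          (\<Prod>l\<in>{1..k div 2}. of_nat n ^ 2 - (4 * of_nat l - 2) ^ 2) / (4 ^ k * fact k))) \<and>
      (n mod 8 = 1 \<longrightarrow>
        (of_int (\<Psi> k) :: rat) =
          (-1) ^ (k div 2) * (of_nat n + 1 - 2 * of_nat k) ^ \<delta> k *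
          (\<Prod>l\<in>{1..k div 2}. (of_nat n + 1) ^ 2 - (4 * of_nat l - 2) ^ 2) / (4 ^ k * fact k)) \<and>
      (n mod 8 = 3 \<longrightarrow>
        (of_int (\<Psi> k) :: rat) =
          (-1) ^ (k div 2 + \<delta> (k - 1)) * (of_nat n + 1) * (of_nat n + 1 - 2 * of_nat k) ^ \<delta> (k - 1) *
          (\<Prod>l\<in>{1..(k - 1) div 2}. (of_nat n + 1) ^ 2 - (4 * of_nat l) ^ 2) / (4 ^ k * fact k)) \<and>
      (n mod 8 = 5 \<longrightarrow>
        (of_int (\<Psi> k) :: rat) =
          (-1) ^ (k div 2 + 1) * (of_nat n + 1 - 2 * of_nat k) ^ \<delta> k *
          (\<Prod>l\<in>{1..k div 2}. (of_nat n + 1) ^ 2 - (4 * of_nat l - 2) ^ 2) / (4 ^ k * fact k)) \<and>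
      (n mod 8 = 7 \<longrightarrow>
        (of_int (\<Psi> k) :: rat) =
          (-1) ^ (k div 2 + \<delta> k) * (of_nat n + 1) * (of_nat n + 1 - 2 * of_nat k) ^ \<delta> (k - 1) *
          (\<Prod>l\<in>{1..(k - 1) div 2}. (of_nat n + 1) ^ 2 - (4 * of_nat l) ^ 2) / (4 ^ k * fact k)))"
proof -
  define m where "m = n div 2"
  define \<Psi> where "\<Psi> = (if even n then even_coeff m else odd_coeff m)"
  have sgn: "of_int (coeff_sign m k) = ((-1) ^ e :: rat)"
    if "coeff_sign m k = (-1) ^ d" "even d = even e" for k d e
    using minus_one_power_cong[OF that(2), where 'a = rat] that(1) by simp
  have expansion: "(x ^ n + y ^ n) / (x + y) ^ \<delta> n =
      (\<Sum>k = 0..n div 2. of_int (\<Psi> k) * (x * y) ^ (n div 2 - k) * (x\<^sup>2 + y\<^sup>2) ^ k)"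
    if "odd n \<longrightarrow> x + y \<noteq> 0" for x y :: complex
  proof (cases "even n")
    case True
    then have "n = 2 * m" "\<delta> n = 0" by (auto simp: m_def \<delta>_def)
    then show ?thesis
      using even_expansion[of x m y] True by (simp add: coeff_form_def \<Psi>_def)
  next
    case False
    then have "n = 2 * m + 1" "\<delta> n = 1" by (auto simp: m_def \<delta>_def odd_iff_mod_2_eq_one)
    then show ?thesis
      using odd_expansion[of x m y] False that by (simp add: coeff_form_def \<Psi>_def)
  qed
  have even_case: "n = 2 * m" "\<Psi> = even_coeff m" if "even n"
    using that by (auto simp: m_def \<Psi>_def)
  have odd_case: "n = 2 * m + 1" "\<Psi> = odd_coeff m" if "odd n"
    using that by (auto simp: m_def \<Psi>_def)
  have even0: "\<Psi> 0 = (if even m then 2 * (-1) ^ (m div 2) else 0)" if "even n"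
    using even_case[OF that] by (simp add: even_coeff_def coeff_sign_def)
  have odd0: "\<Psi> 0 = (if even m then 1 else -1) * (-1) ^ (m div 2)" if "odd n"
    using odd_case[OF that] coeff_sign_even_half[of m 0] coeff_sign_odd_half[of m 0]
    by (simp add: odd_coeff_def)
  note halves = parity_halves_mod_8[of n, folded m_def]
  have c0: "\<Psi> 0 = 2" if "n mod 8 = 0"
    using even0 halves[OF that] by simp
  have c17: "\<Psi> 0 = 1" if "n mod 8 \<in> {1, 7}"
  proof -
    from that consider "n mod 8 = 1" | "n mod 8 = 7" by blast
    then show ?thesis using odd0 by cases (use halves in \<open>simp_all\<close>)
  qed
  have c26: "\<Psi> 0 = 0" if "n mod 8 \<in> {2, 6}"
  proof -
    from that consider "n mod 8 = 2" | "n mod 8 = 6" by blast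
    then show ?thesis using even0 by cases (use halves in \<open>simp_all\<close>)
  qed
  have c35: "\<Psi> 0 = -1" if "n mod 8 \<in> {3, 5}"
  proof -
    from that consider "n mod 8 = 3" | "n mod 8 = 5" by blast
    then show ?thesis using odd0 by cases (use halves in \<open>simp_all\<close>)
  qed
  have c4: "\<Psi> 0 = -2" if "n mod 8 = 4"
    using even0 halves[OF that] by simp
  \<comment> \<open>The excluded parities of \<open>k\<close> are those for which \<open>m - k\<close> is odd.\<close>
  have zero: "\<Psi> k = 0" if "even n" "odd (m + k)" for k
    using that even_case by (simp add: even_coeff_def)
  have r0: "(of_int (\<Psi> k) :: rat) =
      2 * (-1) ^ (k div 2) *
      (\<Prod>l\<in>{0..<k div 2}. of_nat n ^ 2 - (4 * of_nat l) ^ 2) / (4 ^ k * fact k)"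
    if "n mod 8 = 0" "k \<ge> 1" "even k" for k
  proof -
    have n: "even n" and m: "even m" and m2: "even (m div 2)"
      using halves[OF that(1)] by simp_all
    have "of_int (coeff_sign m k) = ((-1) ^ (k div 2) :: rat)"
      using m2 by (intro sgn[OF coeff_sign_even_half[OF m]]) simp
    then show ?thesis
      unfolding even_case(2)[OF n] even_coeff_even_index[OF m that(3) even_case(1)[OF n] that(2)]
      by (simp only: mult_ac)
  qed
  have r2: "(of_int (\<Psi> k) :: rat) =
      2 * (-1) ^ (k div 2) * of_nat n *
      (\<Prod>l\<in>{1..k div 2}. of_nat n ^ 2 - (4 * of_nat l - 2) ^ 2) / (4 ^ k * fact k)"
    if "n mod 8 = 2" "k \<ge> 1" "odd k" for k
  proof -
    have n: "even n" and m: "odd m" and m2: "even (m div 2)"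
      using halves[OF that(1)] by simp_all
    have "even ((k + 1) div 2 + 1) = even (k div 2)"
      using that(2-) by simp
    then have "of_int (coeff_sign m k) = ((-1) ^ (k div 2) :: rat)"
      using m2 by (intro sgn[OF coeff_sign_odd_half[OF m]]) simp
    then show ?thesis
      unfolding even_case(2)[OF n] even_coeff_odd_index[OF m that(3) even_case(1)[OF n]]
      by (simp only: mult_ac)
  qed
  have r4: "(of_int (\<Psi> k) :: rat) =
      2 * (-1) ^ (k div 2 + 1) *
      (\<Prod>l\<in>{0..<k div 2}. of_nat n ^ 2 - (4 * of_nat l) ^ 2) / (4 ^ k * fact k)"
    if "n mod 8 = 4" "k \<ge> 1" "even k" for k
  proof -
    have n: "even n" and m: "even m" and m2: "odd (m div 2)"
      using halves[OF that(1)] by simp_all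
    have "of_int (coeff_sign m k) = ((-1) ^ (k div 2 + 1) :: rat)"
      using m2 by (intro sgn[OF coeff_sign_even_half[OF m]]) simp
    then show ?thesis
      unfolding even_case(2)[OF n] even_coeff_even_index[OF m that(3) even_case(1)[OF n] that(2)]
      by (simp only: mult_ac)
  qed
  have r6: "(of_int (\<Psi> k) :: rat) =
      2 * (-1) ^ (k div 2 + 1) * of_nat n *
      (\<Prod>l\<in>{1..k div 2}. of_nat n ^ 2 - (4 * of_nat l - 2) ^ 2) / (4 ^ k * fact k)"
    if "n mod 8 = 6" "k \<ge> 1" "odd k" for k
  proof -
    have n: "even n" and m: "odd m" and m2: "odd (m div 2)"
      using halves[OF that(1)] by simp_all
    have "odd ((k + 1) div 2 + 1) = even (k div 2 + 1)"
      using that(2-) by simp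
    then have "of_int (coeff_sign m k) = ((-1) ^ (k div 2 + 1) :: rat)"
      using m2 by (intro sgn[OF coeff_sign_odd_half[OF m]]) simp
    then show ?thesis
      unfolding even_case(2)[OF n] even_coeff_odd_index[OF m that(3) even_case(1)[OF n]]
      by (simp only: mult_ac)
  qed
  have r1: "(of_int (\<Psi> k) :: rat) =
      (-1) ^ (k div 2) * (of_nat n + 1 - 2 * of_nat k) ^ \<delta> k *
      (\<Prod>l\<in>{1..k div 2}. (of_nat n + 1) ^ 2 - (4 * of_nat l - 2) ^ 2) / (4 ^ k * fact k)"
    if "n mod 8 = 1" "k \<ge> 1" for k
  proof -
    have n: "odd n" and m: "even m" and m2: "even (m div 2)"
      using halves[OF that(1)] by simp_all
    have "of_int (coeff_sign m k) = ((-1) ^ (k div 2) :: rat)"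
      using m2 by (intro sgn[OF coeff_sign_even_half[OF m]]) simp
    then show ?thesis
      unfolding odd_case(2)[OF n] odd_coeff_even_half[OF m odd_case(1)[OF n] that(2)]
      by (simp only: mult_ac)
  qed
  have r3: "(of_int (\<Psi> k) :: rat) =
      (-1) ^ (k div 2 + \<delta> (k - 1)) * (of_nat n + 1) * (of_nat n + 1 - 2 * of_nat k) ^ \<delta> (k - 1) *
      (\<Prod>l\<in>{1..(k - 1) div 2}. (of_nat n + 1) ^ 2 - (4 * of_nat l) ^ 2) / (4 ^ k * fact k)"
    if "n mod 8 = 3" "k \<ge> 1" for k
  proof -
    have n: "odd n" and m: "odd m" and m2: "even (m div 2)"
      using halves[OF that(1)] by simp_all
    have "even ((k + 1) div 2 + 1) = even (k div 2 + \<delta> (k - 1))"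
      using that(2-) even_half_Suc'[of k] by simp
    then have "of_int (coeff_sign m k) = ((-1) ^ (k div 2 + \<delta> (k - 1)) :: rat)"
      using m2 by (intro sgn[OF coeff_sign_odd_half[OF m]]) simp
    then show ?thesis
      unfolding odd_case(2)[OF n] odd_coeff_odd_half[OF m odd_case(1)[OF n] that(2)]
      by (simp only: mult_ac)
  qed
  have r5: "(of_int (\<Psi> k) :: rat) =
      (-1) ^ (k div 2 + 1) * (of_nat n + 1 - 2 * of_nat k) ^ \<delta> k *
      (\<Prod>l\<in>{1..k div 2}. (of_nat n + 1) ^ 2 - (4 * of_nat l - 2) ^ 2) / (4 ^ k * fact k)"
    if "n mod 8 = 5" "k \<ge> 1" for k
  proof -
    have n: "odd n" and m: "even m" and m2: "odd (m div 2)"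
      using halves[OF that(1)] by simp_all
    have "of_int (coeff_sign m k) = ((-1) ^ (k div 2 + 1) :: rat)"
      using m2 by (intro sgn[OF coeff_sign_even_half[OF m]]) simp
    then show ?thesis
      unfolding odd_case(2)[OF n] odd_coeff_even_half[OF m odd_case(1)[OF n] that(2)]
      by (simp only: mult_ac)
  qed
  have r7: "(of_int (\<Psi> k) :: rat) =
      (-1) ^ (k div 2 + \<delta> k) * (of_nat n + 1) * (of_nat n + 1 - 2 * of_nat k) ^ \<delta> (k - 1) *
      (\<Prod>l\<in>{1..(k - 1) div 2}. (of_nat n + 1) ^ 2 - (4 * of_nat l) ^ 2) / (4 ^ k * fact k)"
    if "n mod 8 = 7" "k \<ge> 1" for k
  proof -
    have n: "odd n" and m: "odd m" and m2: "odd (m div 2)"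
      using halves[OF that(1)] by simp_all
    have "odd ((k + 1) div 2 + 1) = even (k div 2 + \<delta> k)"
      using that(2-) even_half_Suc[of k] by simp
    then have "of_int (coeff_sign m k) = ((-1) ^ (k div 2 + \<delta> k) :: rat)"
      using m2 by (intro sgn[OF coeff_sign_odd_half[OF m]]) simp
    then show ?thesis
      unfolding odd_case(2)[OF n] odd_coeff_odd_half[OF m odd_case(1)[OF n] that(2)]
      by (simp only: mult_ac)
  qed
  have z0: "\<Psi> k = 0" if "n mod 8 = 0 \<or> n mod 8 = 4" "odd k" for k
  proof -
    have "even n" "odd (m + k)" using that halves[of 0] halves[of 4] by auto
    then show ?thesis by (rule zero)
  qed
  have z2: "\<Psi> k = 0" if "n mod 8 = 2 \<or> n mod 8 = 6" "even k" for k
  proof -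
    have "even n" "odd (m + k)" using that halves[of 2] halves[of 6] by auto
    then show ?thesis by (rule zero)
  qed
  show ?thesis
    by (intro exI[of _ \<Psi>] conjI allI ballI impI)
      (use expansion c0 c17 c26 c35 c4 r0 r1 r2 r3 r4 r5 r6 r7 z0 z2
        in \<open>simp_all only: atLeastAtMost_iff simp_thms\<close>)
qed

end
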